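(* Fix $n\in\mathbb{N}$ and a finite set $I\subset\mathbb{N}$. Assume: (1) the set $\mathcal{F}_I=\{p=\{p_i\}_{i=1}^\infty\in\Delta\cap X\mid p_i=0 \text{ for all } i\notin I\}$ is nonempty; (2) $W_iW_j=W_jW_i$ for all $i,j\in\mathbb{N}$; let $\{z_k\}_{k=1}^\infty$ be a complete orthonormal system of $\mathcal{H}$ and $\lambda_k^{(i)}\ge 0$ be such that $W_iz=\sum_{k=1}^\infty\lambda_k^{(i)}\langle z,z_k\rangle z_k$ for all $z\in\mathcal{H}$ and all $i\in\mathbb{N}$ (such a system exists by the commutativity); (3) there exist $n$ distinct elements $z_{\sigma(1)},\dots,z_{\sigma(n)}$ of $\{z_k\}_{k=1}^\infty$ such that for every $i\in I$ the restriction of $W_i$ to $\left(\operatorname{span}\{z_{\sigma(1)},\dots,z_{\sigma(n)}\}\right)^\perp$ is $0$. Then each of the two minimization problems $$\text{minimize } f(p)=-\log\prod_{k=1}^n\mu_k(W(p)) \quad\text{subject to } p\in\mathcal{F}_I,$$ $$\text{minimize } g(p)=\sum_{k=1}^n\frac{1}{\mu_k(W(p))} \quad\text{subject to } p\in\mathcal{F}_I,$$ has an optimal solution, and this optimal solution is unique.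
   Context: $\mathcal{H}$ is an infinite-dimensional separable real Hilbert space with a fixed complete orthonormal system $\{e_i\}_{i=1}^\infty$. $A$ is the infinitesimal generator of a strongly continuous semigroup $\exp(tA)$ on $\mathcal{H}$ that is exponentially stable: there are constants $M,\omega>0$ with $\|\exp(tA)\|\le M e^{-\omega t}$ for all $t\ge 0$. $\Delta=\{\{p_i\}_{i=1}^\infty \mid p_i\ge 0,\ \sum_{i=1}^\infty p_i=1\}$. For $p\in\Delta$, $B=B(p)$ is the bounded linear operator on $\mathcal{H}$ with $Be_i=\sqrt{p_i}\,e_i$ for all $i\in\mathbb{N}$, and the controllability Gramian is $$W(p)=\int_0^\infty \exp(tA)BB^*\exp(tA)^*\,\mathrm{d}t .$$ $W(p)$ is a compact, self-adjoint, positive semidefinite operator; $\mu_k(W(p))$ denotes its $k$-th eigenvalue when the eigenvalues are listed in descending order, counted with multiplicity. For the fixed $n$, $X=\{\{p_i\}_{i=1}^\infty\mid \mu_n(W(p))>0\}$. For $i\in\mathbb{N}$, $P_i$ is the orthogonal projection $P_iz=\langle z,e_i\rangle e_i$ and $$W_i=\int_0^\infty\exp(tA)P_iP_i^*\exp(tA)^*\,\mathrm{d}t .$$ *)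

theory Defs
  imports "HOL-Analysis.Analysis"
begin

(* A separable real Hilbert space is a type of sort {real_inner, banach, second_countable_topology};
   a complete orthonormal system indexed by nat exists only in infinite dimension.  Members of
   such systems, and the entries of sequences p, are numbered from 0. *)

definition complete_orthonormal :: "(nat \<Rightarrow> 'a::real_inner) \<Rightarrow> bool" where
  "complete_orthonormal e \<longleftrightarrow>
     (\<forall>i j. e i \<bullet> e j = (if i = j then 1 else 0)) \<and> closure (span (range e)) = UNIV"

(* S t stands for exp(tA); only times t >= 0 are meaningful. *)

definition C0_semigroup :: "(real \<Rightarrow> 'a::real_normed_vector \<Rightarrow> 'a) \<Rightarrow> bool" where
  "C0_semigroup S \<longleftrightarrow>
     (\<forall>t\<ge>0. bounded_linear (S t)) \<and> S 0 = id \<and>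
     (\<forall>s\<ge>0. \<forall>t\<ge>0. S (s + t) = S s \<circ> S t) \<and>
     (\<forall>x. ((\<lambda>t. S t x) \<longlongrightarrow> x) (at_right 0))"

(* The generator is a partial operator: D is its domain, and A is unconstrained outside D. *)

definition infinitesimal_generator ::
    "(real \<Rightarrow> 'a::real_normed_vector \<Rightarrow> 'a) \<Rightarrow> 'a set \<Rightarrow> ('a \<Rightarrow> 'a) \<Rightarrow> bool" where
  "infinitesimal_generator S D A \<longleftrightarrow>
     D = {x. \<exists>y. ((\<lambda>h. (S h x - x) /\<^sub>R h) \<longlongrightarrow> y) (at_right 0)} \<and>
     (\<forall>x\<in>D. ((\<lambda>h. (S h x - x) /\<^sub>R h) \<longlongrightarrow> A x) (at_right 0))"

definition exponentially_stable :: "(real \<Rightarrow> 'a::real_normed_vector \<Rightarrow> 'a) \<Rightarrow> bool" where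
  "exponentially_stable S \<longleftrightarrow>
     (\<exists>M>0. \<exists>\<omega>>0. \<forall>t\<ge>0. onorm (S t) \<le> M * exp (- \<omega> * t))"

definition prob_sequences :: "(nat \<Rightarrow> real) set" where
  "prob_sequences = {p. (\<forall>i. 0 \<le> p i) \<and> p sums 1}"

definition input_op :: "(nat \<Rightarrow> 'a::real_inner) \<Rightarrow> (nat \<Rightarrow> real) \<Rightarrow> 'a \<Rightarrow> 'a" where
  "input_op e p = (THE B. bounded_linear B \<and> (\<forall>i. B (e i) = sqrt (p i) *\<^sub>R e i))"

definition proj_op :: "(nat \<Rightarrow> 'a::real_inner) \<Rightarrow> nat \<Rightarrow> 'a \<Rightarrow> 'a" where
  "proj_op e i z = (z \<bullet> e i) *\<^sub>R e i"

(* The operator-valued integral is taken in the strong sense, i.e. vector by vector. *)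

definition gramian_of ::
    "(real \<Rightarrow> 'a::{real_inner,banach,second_countable_topology} \<Rightarrow> 'a) \<Rightarrow> ('a \<Rightarrow> 'a) \<Rightarrow> 'a \<Rightarrow> 'a" where
  "gramian_of S B z =
     (LINT t:{0..}|lborel. (S t \<circ> B \<circ> adjoint B \<circ> adjoint (S t)) z)"

definition gramian ::
    "(nat \<Rightarrow> 'a::{real_inner,banach,second_countable_topology}) \<Rightarrow> (real \<Rightarrow> 'a \<Rightarrow> 'a) \<Rightarrow>
     (nat \<Rightarrow> real) \<Rightarrow> 'a \<Rightarrow> 'a" where
  "gramian e S p = gramian_of S (input_op e p)"

definition gramian_single ::
    "(nat \<Rightarrow> 'a::{real_inner,banach,second_countable_topology}) \<Rightarrow> (real \<Rightarrow> 'a \<Rightarrow> 'a) \<Rightarrow>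
     nat \<Rightarrow> 'a \<Rightarrow> 'a" where
  "gramian_single e S i = gramian_of S (proj_op e i)"

(* The eigenvalues in descending order, counted with multiplicity, for a compact positive
   semidefinite W on an infinite-dimensional space.  Multiplicities are matched for positive
   values only: the value 0 fills the tail exactly when there are finitely many positive
   eigenvalues (its eigenspace is then infinite-dimensional), and does not appear otherwise.
   Eigenspaces for positive eigenvalues are finite-dimensional, so that dim is their
   true dimension. *)

definition eigenvalue_listing :: "('a::real_vector \<Rightarrow> 'a) \<Rightarrow> (nat \<Rightarrow> real) \<Rightarrow> bool" where
  "eigenvalue_listing W m \<longleftrightarrow>
     decseq m \<and>
     (\<forall>k. \<exists>x. x \<noteq> 0 \<and> W x = m k *\<^sub>R x) \<and>
     (\<forall>l>0. finite {k. m k = l} \<and> card {k. m k = l} = dim {x. W x = l *\<^sub>R x})"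

(* k counts from 1: mu W 1 is the largest eigenvalue. *)

definition mu :: "('a::real_vector \<Rightarrow> 'a) \<Rightarrow> nat \<Rightarrow> real" where
  "mu W k = (THE m. eigenvalue_listing W m) (k - 1)"

definition X_set ::
    "(nat \<Rightarrow> 'a::{real_inner,banach,second_countable_topology}) \<Rightarrow> (real \<Rightarrow> 'a \<Rightarrow> 'a) \<Rightarrow>
     nat \<Rightarrow> (nat \<Rightarrow> real) set" where
  "X_set e S n = {p. mu (gramian e S p) n > 0}"

definition feasible_set ::
    "(nat \<Rightarrow> 'a::{real_inner,banach,second_countable_topology}) \<Rightarrow> (real \<Rightarrow> 'a \<Rightarrow> 'a) \<Rightarrow>
     nat \<Rightarrow> nat set \<Rightarrow> (nat \<Rightarrow> real) set" where
  "feasible_set e S n I = {p \<in> prob_sequences \<inter> X_set e S n. \<forall>i. i \<notin> I \<longrightarrow> p i = 0}"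

definition log_volume_cost ::
    "(nat \<Rightarrow> 'a::{real_inner,banach,second_countable_topology}) \<Rightarrow> (real \<Rightarrow> 'a \<Rightarrow> 'a) \<Rightarrow>
     nat \<Rightarrow> (nat \<Rightarrow> real) \<Rightarrow> real" where
  "log_volume_cost e S n p = - ln (\<Prod>k=1..n. mu (gramian e S p) k)"

definition inverse_trace_cost ::
    "(nat \<Rightarrow> 'a::{real_inner,banach,second_countable_topology}) \<Rightarrow> (real \<Rightarrow> 'a \<Rightarrow> 'a) \<Rightarrow>
     nat \<Rightarrow> (nat \<Rightarrow> real) \<Rightarrow> real" where
  "inverse_trace_cost e S n p = (\<Sum>k=1..n. 1 / mu (gramian e S p) k)"

end

theory Submission
  imports Defs
begin

text \<open>For \<open>p\<close> supported in \<open>I\<close> the Gramian is \<open>\<Sum>i\<in>I. p i W\<^sub>i\<close>, hence diagonal with respect to \<open>z\<close>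
  and zero off the \<open>n\<close> selected vectors; there its eigenvalues \<open>c\<^sub>j(p)\<close> are linear in \<open>p\<close>. Both
  costs are therefore sums \<open>\<Sum>j. \<phi> (c\<^sub>j(p))\<close> with \<open>\<phi>\<close> decreasing, strictly convex and infinite at
  zero. Compactness of the simplex gives a minimizer. It is unique because \<open>p\<close> is determined by
  \<open>c(p)\<close>, i.e. the \<open>W\<^sub>i\<close> are linearly independent: if \<open>\<Sum>i\<in>I. a\<^sub>i W\<^sub>i = 0\<close>, evaluating the quadratic
  form at \<open>S(h)\<^sup>* x\<close> shows that \<open>\<Sum>i\<in>I. a\<^sub>i \<langle>x, S(t) e\<^sub>i\<rangle>\<^sup>2\<close> has vanishing integral over every
  \<open>[h, \<infinity>)\<close>, so by continuity it vanishes at \<open>t = 0\<close>.\<close>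

section \<open>Eigenvalues of finite-rank diagonal operators\<close>

text \<open>Pigeonhole. If \<open>m' k < m k\<close>, the values \<open>m 0, ..., m k\<close> are
  positive, so each of them has equally large level sets in both listings, namely of the size of the
  eigenspace dimension. In \<open>m\<close> these level sets cover \<open>k + 1\<close> indices, but
  in the decreasing \<open>m'\<close> they fit below \<open>k\<close>.\<close>

lemma eigenvalue_listing_le:
  assumes m: "eigenvalue_listing W m" and m': "eigenvalue_listing W m'"
    and nonneg: "\<And>l x. x \<noteq> 0 \<Longrightarrow> W x = l *\<^sub>R x \<Longrightarrow> 0 \<le> l"
  shows "m k \<le> m' k"
proof (rule ccontr)
  assume "\<not> m k \<le> m' k"
  then have less: "m' k < m k" by simp
  have nonneg': "0 \<le> m' i" for i
    using m' nonneg unfolding eigenvalue_listing_def by metis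
  define V where "V = m ` {..k}"
  have V_ge: "m k \<le> v" if "v \<in> V" for v
    using that m unfolding V_def eigenvalue_listing_def by (auto dest: decseqD)
  then have V_pos: "0 < v" if "v \<in> V" for v
    using that less nonneg'[of k] by force
  have card_level: "finite {i. m i = v} \<and> finite {i. m' i = v} \<and>
      card {i. m i = v} = card {i. m' i = v}" if "v \<in> V" for v
    using m m' V_pos[OF that] unfolding eigenvalue_listing_def by metis
  have "Suc k = card {..k}" by simp
  also have "\<dots> \<le> card (\<Union>v\<in>V. {i. m i = v})"
    by (rule card_mono) (use card_level in \<open>auto simp: V_def\<close>)
  also have "\<dots> = (\<Sum>v\<in>V. card {i. m i = v})"
    by (rule card_UN_disjoint) (use card_level in \<open>auto simp: V_def\<close>)
  also have "\<dots> = (\<Sum>v\<in>V. card {i. m' i = v})"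
    using card_level by simp
  also have "\<dots> = card (\<Union>v\<in>V. {i. m' i = v})"
    by (rule card_UN_disjoint[symmetric]) (use card_level in \<open>auto simp: V_def\<close>)
  also have "\<dots> \<le> card {..<k}"
  proof (rule card_mono)
    show "(\<Union>v\<in>V. {i. m' i = v}) \<subseteq> {..<k}"
    proof safe
      fix i assume "m' i \<in> V"
      then have "m' k < m' i" using V_ge less by fastforce
      moreover have "decseq m'" using m' unfolding eigenvalue_listing_def by blast
      ultimately show "i < k" using decseqD[of m' k i] by force
    qed
  qed simp
  finally show False by simp
qed

text \<open>Comparing in both directions makes the listing unique, so the definite description in
  \<open>mu\<close> denotes \<open>m\<close>. The shift arises because \<open>mu\<close> counts from
  1 and listings from 0.\<close>

lemma mu_eq_listing:
  assumes "eigenvalue_listing W m"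
    and "\<And>l x. x \<noteq> 0 \<Longrightarrow> W x = l *\<^sub>R x \<Longrightarrow> 0 \<le> l"
  shows "mu W k = m (k - 1)"
proof -
  have "(THE m. eigenvalue_listing W m) = m"
    using assms(1) eigenvalue_listing_le[of W, OF _ _ assms(2)]
    by (intro the_equality ext antisym) blast+
  then show ?thesis by (simp add: mu_def)
qed

lemma orthonormal_neq_0:
  assumes "\<And>i j. z i \<bullet> z j = (if i = j then 1 else (0::real))"
  shows "z k \<noteq> 0"
  using assms[of k k] by auto

lemma orthonormal_inj:
  assumes "\<And>i j. z i \<bullet> z j = (if i = j then 1 else (0::real))"
  shows "inj z"
  using assms by (metis injI zero_neq_one)

text \<open>Coefficients may vanish on \<open>J\<close>, so that the locale covers every
  \<open>p\<close> of the simplex before feasibility is known.\<close>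

locale diagonal_op =
  fixes z :: "nat \<Rightarrow> 'a::real_inner" and c :: "nat \<Rightarrow> real" and J :: "nat set"
    and W :: "'a \<Rightarrow> 'a"
  assumes orthonormal: "\<And>i j. z i \<bullet> z j = (if i = j then 1 else 0)"
    and finite_J: "finite J"
    and c_nonneg: "\<And>j. j \<in> J \<Longrightarrow> 0 \<le> c j"
    and W_eq: "\<And>x. W x = (\<Sum>j\<in>J. c j *\<^sub>R ((x \<bullet> z j) *\<^sub>R z j))"
begin

lemma W_inner: "W x \<bullet> z k = (if k \<in> J then c k * (x \<bullet> z k) else 0)"
proof -
  have "W x \<bullet> z k = (\<Sum>j\<in>J. if j = k then c k * (x \<bullet> z k) else 0)"
    unfolding W_eq inner_sum_left by (intro sum.cong) (auto simp: orthonormal)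
  then show ?thesis using finite_J by simp
qed

lemma W_basis: "W (z k) = (if k \<in> J then c k *\<^sub>R z k else 0)"
proof -
  have "W (z k) = (\<Sum>j\<in>J. if j = k then c k *\<^sub>R z k else 0)"
    unfolding W_eq by (intro sum.cong) (auto simp: orthonormal)
  then show ?thesis using finite_J by simp
qed

lemma eigenvalue_nonneg:
  assumes "x \<noteq> 0" and "W x = l *\<^sub>R x"
  shows "0 \<le> l"
proof -
  have "l * (x \<bullet> x) = W x \<bullet> x" using assms by simp
  also have "\<dots> = (\<Sum>j\<in>J. c j * (x \<bullet> z j)\<^sup>2)"
    unfolding W_eq inner_sum_left
    by (intro sum.cong) (auto simp: power2_eq_square inner_commute)
  also have "\<dots> \<ge> 0" by (intro sum_nonneg) (simp add: c_nonneg)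
  finally show ?thesis using assms(1)
    by (metis inner_gt_zero_iff zero_le_mult_iff not_less)
qed

text \<open>For positive \<open>l\<close> an eigenvector is a multiple of its image, hence lies in
  the span of the \<open>z j\<close> with \<open>j\<close> in \<open>J\<close>; comparing
  coefficients removes those with \<open>c j\<close> different from \<open>l\<close>.\<close>

lemma eigenspace_eq:
  assumes "0 < l"
  shows "{x. W x = l *\<^sub>R x} = span (z ` {j \<in> J. c j = l})"
proof safe
  fix x assume x: "W x = l *\<^sub>R x"
  have "x = (1 / l) *\<^sub>R W x" using assms x by simp
  also have "W x \<in> span (z ` {j \<in> J. c j = l})"
    unfolding W_eq
  proof (rule span_sum)
    fix j assume j: "j \<in> J"
    have "c j * (x \<bullet> z j) = l * (x \<bullet> z j)"
      using W_inner[of x j] j x by (metis inner_scaleR_left)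
    then have "c j = l \<or> x \<bullet> z j = 0" by (metis mult_right_cancel)
    then show "c j *\<^sub>R ((x \<bullet> z j) *\<^sub>R z j) \<in> span (z ` {j \<in> J. c j = l})"
      using j by (auto intro: span_mul span_base simp: span_zero)
  qed
  then have "(1 / l) *\<^sub>R W x \<in> span (z ` {j \<in> J. c j = l})" by (rule span_mul)
  finally show "x \<in> span (z ` {j \<in> J. c j = l})" .
next
  fix x assume "x \<in> span (z ` {j \<in> J. c j = l})"
  then show "W x = l *\<^sub>R x"
  proof (induction rule: span_induct_alt)
    case base
    show ?case by (simp add: W_eq)
  next
    case (step a x y)
    have "W (a *\<^sub>R x + y) = a *\<^sub>R W x + W y"
      unfolding W_eq
      by (simp add: inner_left_distrib sum.distrib scaleR_right_distrib scaleR_left_distrib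
          scaleR_sum_right mult_ac)
    moreover have "W x = l *\<^sub>R x" using step W_basis by auto
    ultimately show ?case using step by (simp add: scaleR_right_distrib mult.commute)
  qed
qed

lemma dim_eigenspace:
  assumes "0 < l"
  shows "dim {x. W x = l *\<^sub>R x} = card {j \<in> J. c j = l}"
proof -
  have "independent (z ` {j \<in> J. c j = l})"
    using orthonormal orthonormal_neq_0[of z]
    by (intro pairwise_orthogonal_independent) (auto simp: pairwise_def orthogonal_def)
  then have "dim {x. W x = l *\<^sub>R x} = card (z ` {j \<in> J. c j = l})"
    by (metis eigenspace_eq[OF assms] dim_span_eq_card_independent)
  also have "\<dots> = card {j \<in> J. c j = l}"
    by (rule card_image) (use orthonormal orthonormal_inj in \<open>blast intro: inj_on_subset\<close>)
  finally show ?thesis .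
qed

text \<open>Going through the multiset image keeps coinciding coefficients apart, so counting
  entries yields multiplicities.\<close>

definition sorted_values :: "real list" where
  "sorted_values = rev (sorted_list_of_multiset (image_mset c (mset_set J)))"

lemma mset_sorted_values: "mset sorted_values = image_mset c (mset_set J)"
  by (simp add: sorted_values_def)

lemma set_sorted_values: "set sorted_values = c ` J"
  using arg_cong[OF mset_sorted_values, of set_mset] finite_J by simp

lemma length_sorted_values: "length sorted_values = card J"
  using arg_cong[OF mset_sorted_values, of size] by simp

lemma sorted_values_decreasing:
  assumes "i \<le> j" and "j < card J"
  shows "sorted_values ! j \<le> sorted_values ! i"
proof -
  have "sorted (rev sorted_values)" by (simp add: sorted_values_def)
  then show ?thesis using assms by (simp add: sorted_rev_iff_nth_mono length_sorted_values)
qed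

text \<open>The padding by 0 accounts for the kernel; positive level sets do not see it.\<close>

definition listing :: "nat \<Rightarrow> real" where
  "listing k = (if k < card J then sorted_values ! k else 0)"

lemma listing_in: "k < card J \<Longrightarrow> listing k \<in> c ` J"
  by (metis listing_def length_sorted_values nth_mem set_sorted_values)

lemma eigenvalue_listing_listing: "eigenvalue_listing W listing"
  unfolding eigenvalue_listing_def
proof (intro conjI allI impI)
  show "decseq listing"
    unfolding decseq_def
  proof (intro allI impI)
    fix i j :: nat assume "i \<le> j"
    show "listing j \<le> listing i"
    proof (cases "j < card J")
      case True
      then show ?thesis using sorted_values_decreasing \<open>i \<le> j\<close> by (simp add: listing_def)
    next
      case False
      then show ?thesis using listing_in[of i] c_nonneg by (auto simp: listing_def)
    qed
  qed
next
  fix k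
  show "\<exists>x. x \<noteq> 0 \<and> W x = listing k *\<^sub>R x"
  proof (cases "k < card J")
    case True
    then obtain j where "j \<in> J" "listing k = c j" using listing_in by blast
    then show ?thesis using W_basis[of j] orthonormal_neq_0[of z j] orthonormal by auto
  next
    case False
    \<comment> \<open>Any basis vector with index outside the finite set \<open>J\<close> lies in
      the kernel, so the padding value 0 is an eigenvalue.\<close>
    obtain j where "j \<notin> J" using ex_new_if_finite[OF infinite_UNIV_nat finite_J] by blast
    then show ?thesis using W_basis[of j] orthonormal_neq_0[of z j] orthonormal False
      by (auto simp: listing_def)
  qed
next
  fix l :: real assume l: "0 < l"
  then have eq: "{k. listing k = l} = {k. k < length sorted_values \<and> sorted_values ! k = l}"
    by (auto simp: listing_def length_sorted_values split: if_splits)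
  show "finite {k. listing k = l}" unfolding eq by simp
  have "card {k. listing k = l} = count (mset sorted_values) l"
    unfolding eq count_mset count_list_eq_length_filter length_filter_conv_card
    by (simp add: eq_commute)
  also have "\<dots> = card {j \<in> J. c j = l}"
    unfolding mset_sorted_values count_image_mset
    using finite_J by (simp add: Int_def vimage_def conj_commute)
  finally show "card {k. listing k = l} = dim {x. W x = l *\<^sub>R x}"
    by (simp add: dim_eigenspace[OF l])
qed

text \<open>Both costs are symmetric in the eigenvalues, so only their multiset matters: sorting can
  be forgotten, and sums and products over \<open>mu W k\<close> become sums and products over
  \<open>J\<close>.\<close>

lemma mset_mu: "image_mset (mu W) (mset_set {1..card J}) = image_mset c (mset_set J)"
proof -
  have mu: "mu W (Suc k) = sorted_values ! k" if "k < card J" for k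
    using mu_eq_listing[OF eigenvalue_listing_listing eigenvalue_nonneg] that
    by (simp add: listing_def)
  have "mset_set {1..card J} = image_mset Suc (mset_set {..<card J})"
    by (subst image_mset_mset_set) (auto simp: image_Suc_lessThan)
  then have "image_mset (mu W) (mset_set {1..card J}) =
      image_mset (\<lambda>k. sorted_values ! k) (mset_set {..<card J})"
    using mu by (auto simp: multiset.map_comp intro!: image_mset_cong)
  also have "\<dots> = mset sorted_values"
    by (metis length_sorted_values lessThan_atLeast0 map_nth mset_map mset_upt)
  finally show ?thesis by (simp add: mset_sorted_values)
qed

lemma sum_mu: "(\<Sum>k = 1..card J. f (mu W k)) = (\<Sum>j\<in>J. f (c j))"
  using arg_cong[OF mset_mu, of "\<lambda>M. sum_mset (image_mset f M)"]
  by (simp add: sum_unfold_sum_mset multiset.map_comp comp_def)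

lemma prod_mu: "(\<Prod>k = 1..card J. f (mu W k)) = (\<Prod>j\<in>J. f (c j))"
  using arg_cong[OF mset_mu, of "\<lambda>M. prod_mset (image_mset f M)"]
  by (simp add: prod_unfold_prod_mset multiset.map_comp comp_def)

text \<open>The eigenvalue with number \<open>card J\<close> is the smallest coefficient. This turns
  membership in \<open>X_set\<close> into finitely many strict linear inequalities.\<close>

lemma mu_pos_iff:
  assumes "1 \<le> card J"
  shows "0 < mu W (card J) \<longleftrightarrow> (\<forall>j\<in>J. 0 < c j)"
proof -
  have mu: "mu W (card J) = sorted_values ! (card J - 1)"
    using mu_eq_listing[OF eigenvalue_listing_listing eigenvalue_nonneg] assms
    by (simp add: listing_def)
  have "0 < sorted_values ! (card J - 1) \<longleftrightarrow> (\<forall>v \<in> set sorted_values. 0 < v)"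
  proof
    assume pos: "0 < sorted_values ! (card J - 1)"
    show "\<forall>v \<in> set sorted_values. 0 < v"
    proof
      fix v assume "v \<in> set sorted_values"
      then obtain i where "i < card J" "v = sorted_values ! i"
        by (metis in_set_conv_nth length_sorted_values)
      then show "0 < v" using sorted_values_decreasing[of i "card J - 1"] pos by fastforce
    qed
  next
    assume "\<forall>v \<in> set sorted_values. 0 < v"
    then show "0 < sorted_values ! (card J - 1)"
      using assms length_sorted_values by simp
  qed
  then show ?thesis by (simp add: mu set_sorted_values)
qed

end

section \<open>Separable convex costs on a simplex\<close>

definition simplex_on :: "nat set \<Rightarrow> (nat \<Rightarrow> real) set" where
  "simplex_on I = {p. (\<forall>i. 0 \<le> p i) \<and> (\<forall>i. i \<notin> I \<longrightarrow> p i = 0) \<and> sum p I = 1}"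

text \<open>Tychonoff: the simplex is the closed slice \<open>sum p I = 1\<close> of a product of
  intervals and, outside \<open>I\<close>, of singletons.\<close>

lemma compact_simplex_on:
  assumes "finite I"
  shows "compact (simplex_on I)"
proof -
  define Q where "Q = PiE UNIV (\<lambda>i. if i \<in> I then {0..1} else {0::real})"
  have "compactin (product_topology (\<lambda>i. euclidean) UNIV) Q"
    unfolding Q_def compactin_PiE by auto
  then have "compact Q" by (simp add: euclidean_product_topology)
  moreover have "closed {p :: nat \<Rightarrow> real. sum p I = 1}"
    by (intro closed_Collect_eq continuous_intros continuous_on_product_coordinates)
  moreover have "simplex_on I = Q \<inter> {p. sum p I = 1}"
  proof (intro equalityI subsetI)
    fix p assume p: "p \<in> simplex_on I"
    have "p i \<le> 1" if "i \<in> I" for i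
      using p member_le_sum[OF that, of p] assms by (auto simp: simplex_on_def)
    then show "p \<in> Q \<inter> {p. sum p I = 1}"
      using p by (auto simp: simplex_on_def Q_def PiE_def)
  next
    fix p assume p: "p \<in> Q \<inter> {p. sum p I = 1}"
    then have "p i \<in> (if i \<in> I then {0..1} else {0})" for i
      by (auto simp: Q_def dest!: PiE_mem[where x = i])
    with p show "p \<in> simplex_on I"
      by (force simp: simplex_on_def split: if_splits)
  qed
  ultimately show ?thesis by (simp add: compact_Int_closed)
qed

text \<open>\<open>F\<close> need not be closed, so compactness cannot be applied to it directly.
  The blow-up of \<phi> at 0 keeps all points no worse than a fixed \<open>p0\<close> away from the
  missing boundary.\<close>

lemma ex1_arg_min_separable:
  fixes a :: "nat \<Rightarrow> nat \<Rightarrow> real" and \<phi> :: "real \<Rightarrow> real" and I J :: "nat set"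
  defines "c \<equiv> \<lambda>p j. \<Sum>i\<in>I. p i * a i j"
  defines "F \<equiv> {p \<in> simplex_on I. \<forall>j\<in>J. 0 < c p j}"
  assumes "finite I" and "finite J" and "F \<noteq> {}"
    and a_nonneg: "\<And>i j. 0 \<le> a i j"
    and inj: "\<And>p q. p \<in> F \<Longrightarrow> q \<in> F \<Longrightarrow> (\<And>j. j \<in> J \<Longrightarrow> c p j = c q j) \<Longrightarrow> p = q"
    and cont: "continuous_on {0<..} \<phi>"
    and anti: "\<And>x y. 0 < x \<Longrightarrow> x \<le> y \<Longrightarrow> \<phi> y \<le> \<phi> x"
    and convex: "\<And>x y. 0 < x \<Longrightarrow> 0 < y \<Longrightarrow> x \<noteq> y \<Longrightarrow> \<phi> ((x + y) / 2) < (\<phi> x + \<phi> y) / 2"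
    and blowup: "filterlim \<phi> at_top (at_right 0)"
    and cost: "\<And>p. p \<in> F \<Longrightarrow> cost p = (\<Sum>j\<in>J. \<phi> (c p j))"
  shows "\<exists>!p. is_arg_min cost (\<lambda>p. p \<in> F) p"
proof -
  obtain p0 where p0: "p0 \<in> F" using \<open>F \<noteq> {}\<close> by blast
  \<comment> \<open>\<open>C\<close> bounds every \<open>c p j\<close> over the simplex, since each
    weight \<open>p i\<close> is at most 1. Hence \<open>\<phi> C\<close> bounds every summand of a
    cost from below.\<close>
  define C where "C = 1 + (\<Sum>i\<in>I. \<Sum>j\<in>J. a i j)"
  have "0 < C" unfolding C_def by (intro add_pos_nonneg sum_nonneg a_nonneg) simp
  have c_le: "c p j \<le> C" if p: "p \<in> simplex_on I" and j: "j \<in> J" for p j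
  proof -
    have "c p j \<le> (\<Sum>i\<in>I. \<Sum>j\<in>J. a i j)"
      unfolding c_def
    proof (rule sum_mono)
      fix i assume i: "i \<in> I"
      have "p i \<le> 1" using p member_le_sum[OF i, of p] \<open>finite I\<close> by (auto simp: simplex_on_def)
      then have "p i * a i j \<le> a i j"
        using a_nonneg by (simp add: mult_left_le_one_le p[unfolded simplex_on_def, simplified])
      also have "\<dots> \<le> (\<Sum>j\<in>J. a i j)" by (rule member_le_sum) (use j a_nonneg \<open>finite J\<close> in auto)
      finally show "p i * a i j \<le> (\<Sum>j\<in>J. a i j)" .
    qed
    then show ?thesis by (simp add: C_def)
  qed
  \<comment> \<open>The threshold is chosen so that one summand above it, together with
    \<open>card J - 1\<close> others of size at least \<open>\<phi> C\<close>, makes the cost at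
    least \<open>cost p0 + 1\<close>.\<close>
  have "\<forall>\<^sub>F x in at_right 0. cost p0 - (real (card J) - 1) * \<phi> C + 1 \<le> \<phi> x"
    using blowup by (auto simp: filterlim_at_top)
  then obtain b where "0 < b"
    and b: "\<And>x. 0 < x \<Longrightarrow> x < b \<Longrightarrow> cost p0 - (real (card J) - 1) * \<phi> C + 1 \<le> \<phi> x"
    by (auto simp: eventually_at_right_field)
  have c_ge: "b \<le> c p j" if p: "p \<in> F" and j: "j \<in> J" and le: "cost p \<le> cost p0" for p j
  proof (rule ccontr)
    assume "\<not> b \<le> c p j"
    then have "cost p0 - (real (card J) - 1) * \<phi> C + 1 \<le> \<phi> (c p j)"
      using b p j by (auto simp: F_def)
    moreover have "cost p = \<phi> (c p j) + (\<Sum>k\<in>J - {j}. \<phi> (c p k))"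
      using cost[OF p] j \<open>finite J\<close> by (simp add: sum.remove)
    moreover have "(\<Sum>k\<in>J - {j}. \<phi> C) \<le> (\<Sum>k\<in>J - {j}. \<phi> (c p k))"
      by (intro sum_mono anti) (use p c_le in \<open>auto simp: F_def\<close>)
    moreover have "(\<Sum>k\<in>J - {j}. \<phi> C) = (real (card J) - 1) * \<phi> C"
    proof -
      have "card J \<ge> 1" using j \<open>finite J\<close> by (metis One_nat_def Suc_leI card_gt_0_iff empty_iff)
      then show ?thesis using j \<open>finite J\<close> by (simp add: card_Diff_singleton of_nat_diff)
    qed
    ultimately show False using le by linarith
  qed
  have cont_c: "continuous_on A (\<lambda>p. c p j)" for A j
    unfolding c_def
    by (intro continuous_intros continuous_on_subset[OF continuous_on_product_coordinates]) simp
  \<comment> \<open>\<open>K\<close> contains every feasible point of cost at most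
    \<open>cost p0\<close>. Replacing \<open>0 <\<close> by \<open>b \<le>\<close> makes it closed,
    and \<open>b > 0\<close> keeps it inside \<open>F\<close>, where the cost is continuous.\<close>
  define K where "K = simplex_on I \<inter> (\<Inter>j\<in>J. {p. b \<le> c p j})"
  have K_subset: "K \<subseteq> F" using \<open>0 < b\<close> by (fastforce simp: K_def F_def)
  have "compact K"
    unfolding K_def using \<open>finite I\<close>
    by (intro compact_Int_closed compact_simplex_on closed_INT ballI closed_Collect_le
        continuous_intros cont_c) auto
  moreover have "K \<noteq> {}" using p0 c_ge[OF p0] by (auto simp: K_def F_def)
  moreover have "continuous_on K cost"
  proof -
    have "continuous_on K (\<lambda>p. \<Sum>j\<in>J. \<phi> (c p j))"
      using K_subset
      by (intro continuous_on_sum continuous_on_compose2[OF cont cont_c]) (auto simp: F_def)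
    then show ?thesis using K_subset cost by (subst continuous_on_cong[OF refl]) auto
  qed
  ultimately obtain p where p: "p \<in> K" "\<And>q. q \<in> K \<Longrightarrow> cost p \<le> cost q"
    using continuous_attains_inf by metis
  have p_min: "is_arg_min cost (\<lambda>p. p \<in> F) p"
    unfolding is_arg_min_linorder
  proof (intro conjI allI impI)
    show "p \<in> F" using p K_subset by auto
    fix q assume q: "q \<in> F"
    show "cost p \<le> cost q"
    proof (cases "cost q \<le> cost p0")
      case True
      then have "q \<in> K" using q c_ge by (auto simp: K_def F_def)
      then show ?thesis by (rule p)
    next
      case False
      have "p0 \<in> K" using p0 c_ge[OF p0] by (auto simp: K_def F_def)
      then show ?thesis using p False by fastforce
    qed
  qed
  show ?thesis
  proof (rule ex1I[where a = p], rule p_min)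
    fix q assume "is_arg_min cost (\<lambda>p. p \<in> F) q"
    then have q: "q \<in> F" "\<And>r. r \<in> F \<Longrightarrow> cost q \<le> cost r"
      by (auto simp: is_arg_min_linorder)
    have pF: "p \<in> F" and p_le: "\<And>r. r \<in> F \<Longrightarrow> cost p \<le> cost r"
      using p_min by (auto simp: is_arg_min_linorder)
    show "q = p"
    proof (rule ccontr)
      assume "q \<noteq> p"
      then obtain k where k: "k \<in> J" "c p k \<noteq> c q k" using inj[OF q(1) pF] by metis
      \<comment> \<open>The midpoint of two minimizers is feasible because \<open>c\<close> is
        linear in \<open>p\<close>. Coordinate \<open>k\<close>, where \<open>c p\<close> and
        \<open>c q\<close> differ, makes the convexity inequality strict, so \<open>r\<close> would
        beat both.\<close>
      define r where "r = (\<lambda>i. (p i + q i) / 2)"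
      have c_r: "c r j = (c p j + c q j) / 2" for j
        by (simp add: c_def r_def sum.distrib[symmetric] sum_divide_distrib algebra_simps add_divide_distrib)
      have "r \<in> simplex_on I"
        using pF q(1)
        by (auto simp: F_def simplex_on_def r_def sum.distrib sum_divide_distrib[symmetric])
      moreover have "\<forall>j\<in>J. 0 < c r j"
        using pF q(1) unfolding c_r by (auto simp: F_def add_pos_pos)
      ultimately have "r \<in> F" by (simp add: F_def)
      have "cost r < (\<Sum>j\<in>J. (\<phi> (c p j) + \<phi> (c q j)) / 2)"
        unfolding cost[OF \<open>r \<in> F\<close>] c_r
      proof (rule sum_strict_mono_ex1[OF \<open>finite J\<close>])
        show "\<forall>j\<in>J. \<phi> ((c p j + c q j) / 2) \<le> (\<phi> (c p j) + \<phi> (c q j)) / 2"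
        proof
          fix j assume "j \<in> J"
          then show "\<phi> ((c p j + c q j) / 2) \<le> (\<phi> (c p j) + \<phi> (c q j)) / 2"
            using convex[of "c p j" "c q j"] pF q(1)
            by (cases "c p j = c q j") (auto simp: F_def)
        qed
        show "\<exists>j\<in>J. \<phi> ((c p j + c q j) / 2) < (\<phi> (c p j) + \<phi> (c q j)) / 2"
          using convex[of "c p k" "c q k"] pF q(1) k by (auto simp: F_def)
      qed
      also have "\<dots> = (cost p + cost q) / 2"
        by (simp add: cost pF q(1) sum.distrib sum_divide_distrib[symmetric])
      finally show False using q(2)[OF \<open>r \<in> F\<close>] p_le[OF \<open>r \<in> F\<close>] by simp
    qed
  qed
qed

text \<open>This is the strict inequality of arithmetic and geometric means, seen through the
  logarithm.\<close>

lemma minus_ln_midpoint_less: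
  assumes "0 < x" "0 < y" "x \<noteq> y"
  shows "- ln ((x + y) / 2) < (- ln x + - ln y) / (2::real)"
proof -
  have "0 < (x - y)\<^sup>2" using assms by simp
  then have "x * y < ((x + y) / 2)\<^sup>2" by (simp add: power2_eq_square algebra_simps)
  then have "ln (x * y) < ln (((x + y) / 2)\<^sup>2)" using assms by (subst ln_less_cancel_iff) auto
  then show ?thesis using assms by (simp add: ln_mult ln_realpow)
qed

text \<open>After clearing denominators this is \<open>4 * (x * y) < (x + y) * (x + y)\<close>, that
  is, \<open>(x - y)\<^sup>2 > 0\<close>.\<close>

lemma inverse_midpoint_less:
  assumes "0 < x" "0 < y" "x \<noteq> y"
  shows "1 / ((x + y) / 2) < (1 / x + 1 / y) / (2::real)"
proof -
  have "0 < (x - y)\<^sup>2" using assms by simp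
  then have "4 * (x * y) < (x + y) * (x + y)" by (simp add: power2_eq_square algebra_simps)
  moreover have "(1 / x + 1 / y) / 2 = (x + y) / (2 * (x * y))" using assms by (simp add: field_simps)
  moreover have "1 / ((x + y) / 2) = 2 / (x + y)" by simp
  ultimately show ?thesis using assms by (simp add: divide_simps add.commute)
qed

section \<open>Gramians of stable semigroups\<close>

lemma complete_orthonormal_ext:
  assumes e: "complete_orthonormal e" and f: "bounded_linear f" and g: "bounded_linear g"
    and eq: "\<And>i. f (e i) = g (e i)"
  shows "f = g"
proof
  fix x
  have "f x = g x" if "x \<in> span (range e)" for x
    using that eq f g linear_eq_on_span[of f g "range e" x] by (auto intro: bounded_linear.linear)
  \<comment> \<open>The set of agreement is closed and contains a dense subspace.\<close>
  moreover have "closed {x. f x = g x}"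
    using f g by (intro closed_Collect_eq linear_continuous_on)
  ultimately have "closure (span (range e)) \<subseteq> {x. f x = g x}"
    by (intro closure_minimal) auto
  then show "f x = g x" using e by (auto simp: complete_orthonormal_def)
qed

lemma norm_sum_orthonormal:
  assumes "\<And>i j. e i \<bullet> e j = (if i = j then 1 else (0::real))" and "finite A"
  shows "(norm (\<Sum>i\<in>A. a i *\<^sub>R e i))\<^sup>2 = (\<Sum>i\<in>A. (a i)\<^sup>2)"
proof -
  have "(\<Sum>i\<in>A. a i * (\<Sum>j\<in>A. a j * (e j \<bullet> e i))) = (\<Sum>i\<in>A. (a i)\<^sup>2)"
    unfolding assms(1) using assms(2) by (simp add: power2_eq_square if_distrib cong: if_cong)
  then show ?thesis
    unfolding power2_norm_eq_inner by (simp add: inner_sum_left inner_sum_right)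
qed

text \<open>By Pythagoras the squared norm of a block of the series is the same block of the series
  of squares, so the Cauchy criterion carries over, with tolerance \<open>r\<^sup>2\<close> for
  \<open>r\<close>.\<close>

lemma summable_scaleR_orthonormal:
  fixes e :: "nat \<Rightarrow> 'a::{real_inner, banach}"
  assumes orth: "\<And>i j. e i \<bullet> e j = (if i = j then 1 else 0)" and a: "summable (\<lambda>i. (a i)\<^sup>2)"
  shows "summable (\<lambda>i. a i *\<^sub>R e i)"
  unfolding summable_Cauchy
proof (intro allI impI)
  fix r :: real assume r: "0 < r"
  from a r obtain N where N: "\<And>m n. N \<le> m \<Longrightarrow> norm (\<Sum>i = m..<n. (a i)\<^sup>2) < r\<^sup>2"
    unfolding summable_Cauchy by (meson zero_less_power)
  have "norm (\<Sum>i = m..<n. a i *\<^sub>R e i) < r" if "N \<le> m" for m n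
    using N[OF that, of n] r by (intro power2_less_imp_less[of _ r]) (auto simp: norm_sum_orthonormal[OF orth])
  then show "\<exists>N. \<forall>m\<ge>N. \<forall>n. norm (\<Sum>i = m..<n. a i *\<^sub>R e i) < r" by blast
qed

text \<open>The representing vector is the series of the \<open>f (e i) *\<^sub>R e i\<close>; it
  has the right values on the basis, and density does the rest.\<close>

lemma riesz_representation:
  fixes e :: "nat \<Rightarrow> 'a::{real_inner, banach}" and f :: "'a \<Rightarrow> real"
  assumes e: "complete_orthonormal e" and f: "bounded_linear f"
  shows "\<exists>v. \<forall>x. f x = x \<bullet> v"
proof -
  interpret f: bounded_linear f by fact
  have orth: "e i \<bullet> e j = (if i = j then 1 else 0)" for i j
    using e by (auto simp: complete_orthonormal_def)
  \<comment> \<open>Bessel-type bound: testing \<open>f\<close> on its own truncated series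
    \<open>y\<close> gives \<open>s = f y\<close>, while \<open>norm y = sqrt s\<close>, so
    \<open>s\<close> is at most \<open>onorm f * sqrt s\<close>.\<close>
  have "(\<Sum>i<N. (f (e i))\<^sup>2) \<le> (onorm f)\<^sup>2" for N
  proof -
    define s where "s = (\<Sum>i<N. (f (e i))\<^sup>2)"
    define y where "y = (\<Sum>i<N. f (e i) *\<^sub>R e i)"
    have "0 \<le> s" by (simp add: s_def sum_nonneg)
    have "(norm y)\<^sup>2 = s"
      by (simp add: y_def s_def norm_sum_orthonormal[OF orth])
    then have norm_y: "norm y = sqrt s" by (metis norm_ge_zero real_sqrt_unique)
    have "s = f y" by (simp add: s_def y_def f.sum f.scaleR power2_eq_square)
    also have "\<dots> \<le> onorm f * sqrt s" using onorm[OF f, of y] norm_y by simp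
    finally have "sqrt s * sqrt s \<le> onorm f * sqrt s" using \<open>0 \<le> s\<close> by simp
    then have "sqrt s \<le> onorm f"
      using onorm_pos_le[OF f] \<open>0 \<le> s\<close> mult_right_le_imp_le[of "sqrt s" "sqrt s" "onorm f"]
      by (cases "s = 0") (auto simp del: real_sqrt_mult_self)
    then show ?thesis unfolding s_def[symmetric]
      using \<open>0 \<le> s\<close> by (metis power_mono real_sqrt_ge_zero real_sqrt_pow2)
  qed
  then have "summable (\<lambda>i. (f (e i))\<^sup>2)"
    by (intro summableI_nonneg_bounded[where x = "(onorm f)\<^sup>2"]) auto
  then have sm: "summable (\<lambda>i. f (e i) *\<^sub>R e i)" by (rule summable_scaleR_orthonormal[OF orth])
  define v where "v = (\<Sum>i. f (e i) *\<^sub>R e i)"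
  have "f (e k) = e k \<bullet> v" for k
  proof -
    have "(\<lambda>i. e k \<bullet> (f (e i) *\<^sub>R e i)) sums (e k \<bullet> v)"
      unfolding v_def by (intro bounded_linear.sums[OF bounded_linear_inner_right] summable_sums sm)
    moreover have "(\<lambda>i. e k \<bullet> (f (e i) *\<^sub>R e i)) = (\<lambda>i. if i = k then f (e i) else 0)"
      by (auto simp: orth)
    ultimately show ?thesis using sums_single[of k "\<lambda>i. f (e i)"] by (simp add: sums_iff)
  qed
  then have "f = (\<lambda>x. x \<bullet> v)"
    by (intro complete_orthonormal_ext[OF e f] bounded_linear_inner_left)
  then show ?thesis by metis
qed

text \<open>\<open>adjoint\<close> is defined by choice, so its defining identity is available only
  once some adjoint exists; Riesz representation of \<open>\<lambda>x. f x \<bullet> y\<close>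
  supplies one.\<close>

lemma inner_adjoint:
  fixes e :: "nat \<Rightarrow> 'a::{real_inner, banach}" and f :: "'a \<Rightarrow> 'a"
  assumes e: "complete_orthonormal e" and f: "bounded_linear f"
  shows "x \<bullet> adjoint f y = f x \<bullet> y"
proof -
  have "\<exists>v. \<forall>x. f x \<bullet> y = x \<bullet> v" for y
    by (intro riesz_representation[OF e] bounded_linear_compose[OF bounded_linear_inner_left f, unfolded o_def])
  then have "\<exists>f'. \<forall>x y. f x \<bullet> y = x \<bullet> f' y" by metis
  from someI_ex[OF this, folded adjoint_def] show ?thesis by metis
qed

section \<open>Finite diagonal operators: a common form for projections and input operators\<close>

definition diag_op :: "(nat \<Rightarrow> 'a::real_inner) \<Rightarrow> nat set \<Rightarrow> (nat \<Rightarrow> real) \<Rightarrow> 'a \<Rightarrow> 'a" where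
  "diag_op e I a x = (\<Sum>i\<in>I. (a i * (x \<bullet> e i)) *\<^sub>R e i)"

lemma bounded_linear_diag_op: "bounded_linear (diag_op e I a)"
  unfolding diag_op_def
  by (intro bounded_linear_sum bounded_linear_scaleR_const bounded_linear_const_mult
      bounded_linear_inner_left)

lemma adjoint_diag_op: "adjoint (diag_op e I a) = diag_op e I a"
proof (rule adjoint_unique, intro allI)
  fix x y
  show "diag_op e I a x \<bullet> y = x \<bullet> diag_op e I a y"
    unfolding diag_op_def inner_sum_left inner_sum_right
    by (intro sum.cong) (auto simp: inner_commute)
qed

lemma diag_op_diag_op:
  assumes "\<And>i j. e i \<bullet> e j = (if i = j then 1 else (0::real))" and "finite I"
  shows "diag_op e I a (diag_op e I b x) = diag_op e I (\<lambda>i. a i * b i) x"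
proof -
  have "diag_op e I b x \<bullet> e i = b i * (x \<bullet> e i)" if "i \<in> I" for i
  proof -
    have "diag_op e I b x \<bullet> e i = (\<Sum>j\<in>I. if j = i then b i * (x \<bullet> e i) else 0)"
      unfolding diag_op_def inner_sum_left by (intro sum.cong) (auto simp: assms(1))
    then show ?thesis using that assms(2) by simp
  qed
  then show ?thesis unfolding diag_op_def[of e I a] diag_op_def[of e I "\<lambda>i. a i * b i"]
    by (intro sum.cong) auto
qed

lemma proj_op_eq_diag_op: "proj_op e i = diag_op e {i} (\<lambda>_. 1)"
  by (simp add: fun_eq_iff proj_op_def diag_op_def)

text \<open>A bounded operator is determined by its values on the basis, which resolves the definite
  description in \<open>input_op\<close>; finite support of \<open>p\<close> makes existence
  immediate.\<close>

lemma input_op_eq_diag_op: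
  assumes e: "complete_orthonormal e" and "finite I" and "\<And>i. i \<notin> I \<Longrightarrow> p i = 0"
  shows "input_op e p = diag_op e I (\<lambda>i. sqrt (p i))"
  unfolding input_op_def
proof (rule the_equality)
  have orth: "e i \<bullet> e j = (if i = j then 1 else 0)" for i j
    using e by (auto simp: complete_orthonormal_def)
  have basis: "diag_op e I (\<lambda>i. sqrt (p i)) (e k) = sqrt (p k) *\<^sub>R e k" for k
  proof -
    have "diag_op e I (\<lambda>i. sqrt (p i)) (e k) = (\<Sum>i\<in>I. if i = k then sqrt (p k) *\<^sub>R e k else 0)"
      unfolding diag_op_def by (intro sum.cong) (auto simp: orth)
    then show ?thesis using assms(2,3) by simp
  qed
  then show "bounded_linear (diag_op e I (\<lambda>i. sqrt (p i))) \<and>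
      (\<forall>k. diag_op e I (\<lambda>i. sqrt (p i)) (e k) = sqrt (p k) *\<^sub>R e k)"
    using bounded_linear_diag_op by blast
  fix B assume "bounded_linear B \<and> (\<forall>i. B (e i) = sqrt (p i) *\<^sub>R e i)"
  then show "B = diag_op e I (\<lambda>i. sqrt (p i))"
    using basis bounded_linear_diag_op by (intro complete_orthonormal_ext[OF e]) auto
qed

section \<open>Exponentially stable semigroups and their Gramians\<close>

locale stable_semigroup =
  fixes e :: "nat \<Rightarrow> 'a::{real_inner,banach,second_countable_topology}"
    and S :: "real \<Rightarrow> 'a \<Rightarrow> 'a"
  assumes basis: "complete_orthonormal e"
    and semigroup: "C0_semigroup S"
    and stable: "exponentially_stable S"
begin

lemma orthonormal: "e i \<bullet> e j = (if i = j then 1 else 0)"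
  using basis by (auto simp: complete_orthonormal_def)

lemma bounded_linear_S: "0 \<le> t \<Longrightarrow> bounded_linear (S t)"
  using semigroup by (auto simp: C0_semigroup_def)

lemma S_add: "0 \<le> s \<Longrightarrow> 0 \<le> t \<Longrightarrow> S (s + t) x = S s (S t x)"
  using semigroup by (auto simp: C0_semigroup_def)

lemma S_0: "S 0 x = x"
  using semigroup by (auto simp: C0_semigroup_def)

lemma exponential_bound:
  obtains M \<omega> where "0 < M" "0 < \<omega>" "\<And>t x. 0 \<le> t \<Longrightarrow> norm (S t x) \<le> M * exp (- \<omega> * t) * norm x"
proof -
  obtain M \<omega> where M: "0 < M" "0 < \<omega>" "\<And>t. 0 \<le> t \<Longrightarrow> onorm (S t) \<le> M * exp (- \<omega> * t)"
    using stable by (auto simp: exponentially_stable_def)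
  have "norm (S t x) \<le> M * exp (- \<omega> * t) * norm x" if "0 \<le> t" for t x
    using onorm[OF bounded_linear_S[OF that], of x] M(3)[OF that]
    by (meson mult_right_mono norm_ge_zero order_trans)
  with M that show ?thesis by blast
qed

text \<open>For \<open>s \<le> t\<close> the difference \<open>S t x - S s x = S s (S (t - s) x - x)\<close> is small uniformly in
  the smaller time \<open>s\<close>, which yields left as well as right continuity.\<close>

lemma continuous_on_S: "continuous_on {0..} (\<lambda>t. S t x)"
proof -
  obtain M \<omega> where M: "0 < M" "0 < \<omega>"
    and bound: "\<And>t y. 0 \<le> t \<Longrightarrow> norm (S t y) \<le> M * exp (- \<omega> * t) * norm y"
    using exponential_bound by blast
  have bound': "norm (S t y) \<le> M * norm y" if "0 \<le> t" for t y
  proof -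
    have "M * exp (- \<omega> * t) * norm y \<le> M * 1 * norm y"
      using M that by (intro mult_mono) auto
    with bound[OF that, of y] show ?thesis by simp
  qed
  have diff: "norm (S t x - S s x) \<le> M * norm (S (t - s) x - x)" if "0 \<le> s" "s \<le> t" for s t
  proof -
    have "S t x = S s (S (t - s) x)" using S_add[of s "t - s" x] that by simp
    then have "S t x - S s x = S s (S (t - s) x - x)"
      using bounded_linear_S[OF that(1)] by (simp add: linear_diff bounded_linear.linear)
    then show ?thesis using bound'[OF that(1)] by metis
  qed
  show ?thesis
    unfolding continuous_on_iff
  proof (intro ballI allI impI)
    fix s r :: real assume s: "s \<in> {0..}" and r: "0 < r"
    have "((\<lambda>t. S t x) \<longlongrightarrow> x) (at_right 0)" using semigroup by (auto simp: C0_semigroup_def)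
    then have "\<forall>\<^sub>F h in at_right 0. dist (S h x) x < r / M" using M r by (intro tendstoD) auto
    then obtain d where d: "0 < d" "\<And>h. 0 < h \<Longrightarrow> h < d \<Longrightarrow> dist (S h x) x < r / M"
      by (auto simp: eventually_at_right_field)
    have close: "norm (S t x - S s x) < r" if "0 \<le> s" "s \<le> t" "t - s < d" for s t
    proof -
      have "norm (S (t - s) x - x) < r / M"
        using d(2)[of "t - s"] that M r by (cases "t = s") (auto simp: dist_norm S_0)
      then have "M * norm (S (t - s) x - x) < r" using M by (simp add: field_simps)
      with diff[OF that(1,2)] show ?thesis by simp
    qed
    have "dist (S t x) (S s x) < r" if "t \<in> {0..}" "dist t s < d" for t
      using close[of s t] close[of t s] s that
      by (cases "s \<le> t") (auto simp: dist_norm norm_minus_commute)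
    then show "\<exists>d>0. \<forall>t\<in>{0..}. dist t s < d \<longrightarrow> dist (S t x) (S s x) < r"
      using d(1) by blast
  qed
qed

text \<open>Both factors \<open>S t y\<close> decay like \<open>exp (- \<omega> * t)\<close>, so the
  integrand is dominated by a multiple of \<open>exp (- (2 * \<omega>) * t)\<close>; continuity
  gives measurability.\<close>

lemma set_integrable_S: "set_integrable lborel {0..} (\<lambda>t. (x \<bullet> S t y) *\<^sub>R S t y)"
proof -
  obtain M \<omega> where M: "0 < M" "0 < \<omega>"
    and bound: "\<And>t y. 0 \<le> t \<Longrightarrow> norm (S t y) \<le> M * exp (- \<omega> * t) * norm y"
    using exponential_bound by blast
  define C where "C = norm x * (M * norm y)\<^sup>2"
  have "(\<lambda>t. exp (- (2 * \<omega>) * t)) absolutely_integrable_on {0..}"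
    using M by (intro nonnegative_absolutely_integrable_1 integrable_on_exp_minus_to_infinity) auto
  \<comment> \<open>Absolute integrability refers to the completed measure; Borel measurability of
    the continuous integrand brings it down to \<open>lborel\<close>.\<close>
  then have "set_integrable lborel {0..} (\<lambda>t. exp (- (2 * \<omega>) * t))"
    unfolding set_integrable_def
    by (subst (asm) integrable_completion) (auto intro!: borel_measurable_continuous_on_indicator continuous_intros
        simp del: real_scaleR_def)
  then have "set_integrable lborel {0..} (\<lambda>t. C * exp (- (2 * \<omega>) * t))" by simp
  then show ?thesis
  proof (rule set_integrable_bound)
    show "set_borel_measurable lborel {0..} (\<lambda>t. (x \<bullet> S t y) *\<^sub>R S t y)"
      unfolding set_borel_measurable_def measurable_lborel2
      by (intro borel_measurable_continuous_on_indicator continuous_intros continuous_on_S) auto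
    show "AE t in lborel. t \<in> {0..} \<longrightarrow>
        norm ((x \<bullet> S t y) *\<^sub>R S t y) \<le> norm (C * exp (- (2 * \<omega>) * t))"
    proof (intro AE_I2 impI)
      fix t :: real assume t: "t \<in> {0..}"
      have "norm ((x \<bullet> S t y) *\<^sub>R S t y) \<le> norm x * norm (S t y) * norm (S t y)"
        using Cauchy_Schwarz_ineq2[of x "S t y"] by (simp add: mult_right_mono)
      also have "\<dots> \<le> norm x * (M * exp (- \<omega> * t) * norm y) * (M * exp (- \<omega> * t) * norm y)"
        using bound[of t y] t M by (intro mult_mono) auto
      also have "\<dots> = C * exp (- (2 * \<omega>) * t)"
        by (simp add: C_def power2_eq_square mult_exp_exp)
      also have "\<dots> = norm (C * exp (- (2 * \<omega>) * t))" by (simp add: C_def)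
      finally show "norm ((x \<bullet> S t y) *\<^sub>R S t y) \<le> norm (C * exp (- (2 * \<omega>) * t))" .
    qed
  qed
qed

lemma adjoint_S_inner: "0 \<le> t \<Longrightarrow> adjoint (S t) x \<bullet> y = x \<bullet> S t y"
  using inner_adjoint[OF basis bounded_linear_S, of t y x] by (simp add: inner_commute)

text \<open>Moving \<open>adjoint (S t)\<close> across the inner product leaves a sum of rank-one
  terms in the orbits \<open>S t (e i)\<close>, to which continuity and decay of the semigroup
  apply.\<close>

lemma S_diag_op_adjoint:
  assumes "0 \<le> t"
  shows "S t (diag_op e I a (adjoint (S t) x)) = (\<Sum>i\<in>I. a i *\<^sub>R ((x \<bullet> S t (e i)) *\<^sub>R S t (e i)))"
proof -
  interpret bounded_linear "S t" using bounded_linear_S[OF assms] .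
  show ?thesis
    by (simp add: diag_op_def sum scaleR adjoint_S_inner[OF assms])
qed

lemma gramian_single_eq:
  "gramian_single e S i x = (LINT t:{0..}|lborel. (x \<bullet> S t (e i)) *\<^sub>R S t (e i))"
  unfolding gramian_single_def gramian_of_def
  by (intro set_lebesgue_integral_cong)
    (auto simp: proj_op_eq_diag_op adjoint_diag_op diag_op_diag_op[OF orthonormal] S_diag_op_adjoint)

lemma sum_gramian_single:
  assumes "finite I"
  shows "(LINT t:{0..}|lborel. \<Sum>i\<in>I. a i *\<^sub>R ((x \<bullet> S t (e i)) *\<^sub>R S t (e i))) =
    (\<Sum>i\<in>I. a i *\<^sub>R gramian_single e S i x)"
proof -
  have int: "set_integrable lborel {0..} (\<lambda>t. a i *\<^sub>R ((x \<bullet> S t (e i)) *\<^sub>R S t (e i)))" for i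
    by (intro set_integrable_scaleR_right set_integrable_S)
  have "(LINT t:{0..}|lborel. \<Sum>i\<in>I. a i *\<^sub>R ((x \<bullet> S t (e i)) *\<^sub>R S t (e i))) =
      (\<Sum>i\<in>I. LINT t:{0..}|lborel. a i *\<^sub>R ((x \<bullet> S t (e i)) *\<^sub>R S t (e i)))"
    unfolding set_lebesgue_integral_def scaleR_sum_right
    by (rule Bochner_Integration.integral_sum) (rule int[unfolded set_integrable_def])
  then show ?thesis unfolding set_integral_scaleR_right gramian_single_eq .
qed

text \<open>The weights of \<open>B\<close> composed with its adjoint are
  \<open>sqrt (p i) * sqrt (p i) = p i\<close>, so the square roots disappear and the Gramian is
  linear in \<open>p\<close>.\<close>

lemma gramian_eq_sum:
  assumes "finite I" and "\<And>i. 0 \<le> p i" and "\<And>i. i \<notin> I \<Longrightarrow> p i = 0"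
  shows "gramian e S p x = (\<Sum>i\<in>I. p i *\<^sub>R gramian_single e S i x)"
proof -
  have "gramian e S p x = (LINT t:{0..}|lborel. \<Sum>i\<in>I. p i *\<^sub>R ((x \<bullet> S t (e i)) *\<^sub>R S t (e i)))"
    unfolding gramian_def gramian_of_def
    by (intro set_lebesgue_integral_cong)
      (auto simp: input_op_eq_diag_op[OF basis assms(1,3)] adjoint_diag_op
        diag_op_diag_op[OF orthonormal assms(1)] S_diag_op_adjoint assms(2))
  then show ?thesis using sum_gramian_single[OF assms(1)] by simp
qed

lemma gramian_single_independent:
  assumes "finite I" and zero: "\<And>x. (\<Sum>i\<in>I. a i *\<^sub>R gramian_single e S i x) = 0" and "k \<in> I"
  shows "a k = 0"
proof -
  \<comment> \<open>\<open>g x\<close> is the integrand of the quadratic form of the vanishing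
    combination, evaluated at \<open>x\<close>.\<close>
  define g where "g x t = (\<Sum>i\<in>I. a i * (x \<bullet> S t (e i))\<^sup>2)" for x t
  have g_inner: "g x t = (\<Sum>i\<in>I. a i *\<^sub>R ((x \<bullet> S t (e i)) *\<^sub>R S t (e i))) \<bullet> x" for x t
    unfolding g_def inner_sum_left
    by (intro sum.cong) (auto simp: power2_eq_square inner_commute)
  have vec_int: "set_integrable lborel {0..}
      (\<lambda>t. \<Sum>i\<in>I. a i *\<^sub>R ((x \<bullet> S t (e i)) *\<^sub>R S t (e i)))" for x
  proof -
    have "set_integrable lborel {0..} (\<lambda>t. a i *\<^sub>R ((x \<bullet> S t (e i)) *\<^sub>R S t (e i)))" for i
      by (intro set_integrable_scaleR_right set_integrable_S)
    then show ?thesis unfolding set_integrable_def scaleR_sum_right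
      by (rule Bochner_Integration.integrable_sum)
  qed
  have g_int: "set_integrable lborel {0..} (g x)" for x
    using integrable_inner_left[of x lborel, OF vec_int[of x, unfolded set_integrable_def]]
    by (simp add: g_inner set_integrable_def)
  have g_zero: "(LINT t:{0..}|lborel. g x t) = 0" for x
  proof -
    have "(LINT t:{0..}|lborel. g x t) =
        (LINT t:{0..}|lborel. \<Sum>i\<in>I. a i *\<^sub>R ((x \<bullet> S t (e i)) *\<^sub>R S t (e i))) \<bullet> x"
      using integral_inner_left[of x lborel, OF vec_int[of x, unfolded set_integrable_def]]
      by (simp add: g_inner set_lebesgue_integral_def)
    then show ?thesis using sum_gramian_single[OF \<open>finite I\<close>] zero by simp
  qed
  \<comment> \<open>By the semigroup law, replacing \<open>x\<close> by
    \<open>adjoint (S h) x\<close> shifts time by \<open>h\<close>. Since the total integral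
    vanishes for every vector, so do all tail integrals.\<close>
  have shift: "g (adjoint (S h) x) t = g x (t + h)" if "0 \<le> h" "0 \<le> t" for h t x
    using that S_add[of h t] by (simp add: g_def adjoint_S_inner add.commute)
  have tail: "(LINT t:{h..}|lborel. g x t) = 0" if h: "0 \<le> h" for h x
  proof -
    have "(LINT t:{h..}|lborel. g x t) = (\<integral>t. indicator {h..} (h + 1 * t) *\<^sub>R g x (h + 1 * t) \<partial>lborel)"
      unfolding set_lebesgue_integral_def by (subst lborel_integral_real_affine[of 1 _ h]) auto
    also have "\<dots> = (LINT t:{0..}|lborel. g (adjoint (S h) x) t)"
      unfolding set_lebesgue_integral_def
      by (intro Bochner_Integration.integral_cong) (auto simp: shift[OF h] indicator_def add.commute)
    finally show ?thesis by (simp add: g_zero)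
  qed
  have cont: "continuous_on {0..1} (g x)" for x
    unfolding g_def
    by (intro continuous_intros continuous_on_subset[OF continuous_on_S]) auto
  have initial: "integral {0..h} (g x) = 0" if h: "0 \<le> h" "h \<le> 1" for h x
  proof -
    \<comment> \<open>The half-open interval makes the union with the tail disjoint; its missing
      endpoint is a null set and is restored below.\<close>
    have ico: "set_integrable lborel {0..<h} (g x)" and icc: "set_integrable lborel {h..} (g x)"
      and icc': "set_integrable lborel {0..h} (g x)"
      using h by (auto intro!: set_integrable_subset[OF g_int])
    have "(LINT t:{0..<h} \<union> {h..}|lborel. g x t) = (LINT t:{0..<h}|lborel. g x t) + (LINT t:{h..}|lborel. g x t)"
      using ico icc by (intro set_integral_Un) auto
    moreover have "{0..<h} \<union> {h..} = {0..}" using h by auto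
    ultimately have "(LINT t:{0..<h}|lborel. g x t) = 0" using g_zero tail[OF h(1)] by simp
    moreover have "(LINT t:{0..<h}|lborel. g x t) = (LINT t:{0..h}|lborel. g x t)"
      unfolding set_lebesgue_integral_def
      by (rule integral_discrete_difference[where X = "{h}"]) (auto simp: indicator_def)
    ultimately show ?thesis using set_borel_integral_eq_integral(2)[OF icc'] by simp
  qed
  have "g x 0 = 0" for x
  proof -
    \<comment> \<open>The integral from 0 to \<open>u\<close> is constantly 0 in \<open>u\<close>,
      but its one-sided derivative at 0 is \<open>g x 0\<close> by continuity.\<close>
    have "((\<lambda>u. integral {0..u} (g x)) has_vector_derivative g x 0) (at 0 within {0..1})"
      by (rule integral_has_vector_derivative[OF cont]) simp
    then have "((\<lambda>u. 0) has_vector_derivative g x 0) (at 0 within {0..1})"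
      by (rule has_vector_derivative_transform[rotated 2]) (auto simp: initial)
    then show ?thesis
      using vector_derivative_unique_within_closed_interval[of 0 1 0 "\<lambda>u. 0::real" "g x 0" 0]
      by simp
  qed
  \<comment> \<open>At time 0 the semigroup is the identity, so orthonormality isolates the
    coefficient \<open>a k\<close>.\<close>
  from this[of "e k"] have "(\<Sum>i\<in>I. if i = k then a k else 0) = 0"
    by (simp add: g_def S_0 orthonormal if_distrib[of "\<lambda>u. _ * u\<^sup>2"] eq_commute[of k] cong: if_cong)
  then show ?thesis using assms(1,3) by simp
qed

end

section \<open>Reduction of both minimization problems to the separable case\<close>

theorem theorem3p17:
  fixes e z :: "nat \<Rightarrow> 'a::{real_inner,banach,second_countable_topology}"
    and A :: "'a \<Rightarrow> 'a" and D :: "'a set" and S :: "real \<Rightarrow> 'a \<Rightarrow> 'a"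
    and n :: nat and I :: "nat set"
    and lam :: "nat \<Rightarrow> nat \<Rightarrow> real" and \<sigma> :: "nat \<Rightarrow> nat"
  assumes "complete_orthonormal e"
    and "C0_semigroup S" and "infinitesimal_generator S D A" and "exponentially_stable S"
    and "n \<ge> 1" and "finite I"
    and "feasible_set e S n I \<noteq> {}"
    and "\<And>i j. gramian_single e S i \<circ> gramian_single e S j =
                gramian_single e S j \<circ> gramian_single e S i"
    and "complete_orthonormal z"
    and "\<And>i k. lam i k \<ge> 0"
    and "\<And>i x. (\<lambda>k. lam i k *\<^sub>R ((x \<bullet> z k) *\<^sub>R z k)) sums gramian_single e S i x"
    and "inj_on \<sigma> {1..n}"
    and "\<And>i x. i \<in> I \<Longrightarrow> x \<in> orthogonal_comp (span (z ` \<sigma> ` {1..n})) \<Longrightarrow>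
                gramian_single e S i x = 0"
  shows "(\<exists>!p. is_arg_min (log_volume_cost e S n) (\<lambda>p. p \<in> feasible_set e S n I) p) \<and>
         (\<exists>!p. is_arg_min (inverse_trace_cost e S n) (\<lambda>p. p \<in> feasible_set e S n I) p)"
proof -
  interpret stable_semigroup e S using assms by unfold_locales
  define J where "J = \<sigma> ` {1..n}"
  define c where "c p j = (\<Sum>i\<in>I. p i * lam i j)" for p j
  define F where "F = {p \<in> simplex_on I. \<forall>j\<in>J. 0 < c p j}"
  have J: "finite J" "card J = n" using assms(12) by (auto simp: J_def card_image)
  have z_orth: "z i \<bullet> z j = (if i = j then 1 else 0)" for i j
    using assms(9) by (auto simp: complete_orthonormal_def)
  have single_z: "gramian_single e S i (z k) = lam i k *\<^sub>R z k" for i k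
  proof -
    have "(\<lambda>l. lam i l *\<^sub>R ((z k \<bullet> z l) *\<^sub>R z l)) = (\<lambda>l. if l = k then lam i l *\<^sub>R z l else 0)"
      by (auto simp: z_orth)
    then show ?thesis
      using assms(11)[of i "z k"] sums_single[of k "\<lambda>l. lam i l *\<^sub>R z l"] sums_unique2 by force
  qed
  \<comment> \<open>For \<open>k\<close> outside \<open>J\<close> the vector \<open>z k\<close> is
    orthogonal to the selected span, so assumption (3) forces its eigenvalue under
    \<open>W\<^sub>i\<close> to be 0. The spectral series of \<open>W\<^sub>i\<close> thereby
    becomes a finite sum.\<close>
  have lam_0: "lam i k = 0" if "i \<in> I" "k \<notin> J" for i k
  proof -
    have "orthogonal (z k) x" if "x \<in> span (z ` J)" for x
      using that by (rule orthogonal_to_span) (use \<open>k \<notin> J\<close> in \<open>auto simp: orthogonal_def z_orth\<close>)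
    then have "z k \<in> orthogonal_comp (span (z ` J))" by (simp add: orthogonal_comp_def orthogonal_commute)
    then show ?thesis
      using assms(13)[OF that(1), of "z k"] single_z[of i k] orthonormal_neq_0[of z k] z_orth
      by (simp add: J_def)
  qed
  have single: "gramian_single e S i x = (\<Sum>j\<in>J. lam i j *\<^sub>R ((x \<bullet> z j) *\<^sub>R z j))" if "i \<in> I" for i x
    by (rule sums_unique2[OF assms(11) sums_finite]) (auto simp: J lam_0 that)
  have gram: "gramian e S p x = (\<Sum>j\<in>J. c p j *\<^sub>R ((x \<bullet> z j) *\<^sub>R z j))" if "p \<in> simplex_on I" for p x
  proof -
    have "gramian e S p x = (\<Sum>i\<in>I. p i *\<^sub>R (\<Sum>j\<in>J. lam i j *\<^sub>R ((x \<bullet> z j) *\<^sub>R z j)))"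
      using that gramian_eq_sum[OF assms(6), of p x] single by (simp add: simplex_on_def)
    also have "\<dots> = (\<Sum>i\<in>I. \<Sum>j\<in>J. (p i * lam i j) *\<^sub>R ((x \<bullet> z j) *\<^sub>R z j))"
      by (simp add: scaleR_sum_right mult.assoc)
    also have "\<dots> = (\<Sum>j\<in>J. \<Sum>i\<in>I. (p i * lam i j) *\<^sub>R ((x \<bullet> z j) *\<^sub>R z j))" by (rule sum.swap)
    finally show ?thesis by (simp only: c_def scaleR_left.sum)
  qed
  have diag: "diagonal_op z (c p) J (gramian e S p)" if "p \<in> simplex_on I" for p
  proof
    show "0 \<le> c p j" for j
      using that assms(10) by (auto simp: c_def simplex_on_def intro!: sum_nonneg)
  qed (use z_orth J gram[OF that] in auto)
  \<comment> \<open>Vanishing off the finite set \<open>I\<close> turns the infinite series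
    condition into \<open>sum p I = 1\<close>.\<close>
  have simplex: "p \<in> prob_sequences \<and> (\<forall>i. i \<notin> I \<longrightarrow> p i = 0) \<longleftrightarrow> p \<in> simplex_on I" for p
    using sums_finite[OF assms(6), of p] sums_unique2[of p "sum p I" 1]
    by (auto simp: prob_sequences_def simplex_on_def)
  have feasible: "feasible_set e S n I = F"
  proof -
    have "0 < mu (gramian e S p) n \<longleftrightarrow> (\<forall>j\<in>J. 0 < c p j)" if "p \<in> simplex_on I" for p
      using diagonal_op.mu_pos_iff[OF diag[OF that]] assms(5) J by simp
    then show ?thesis using simplex by (auto simp: feasible_set_def X_set_def F_def)
  qed
  have log_cost: "log_volume_cost e S n p = (\<Sum>j\<in>J. - ln (c p j))" if "p \<in> F" for p
  proof -
    have p: "p \<in> simplex_on I" "\<And>j. j \<in> J \<Longrightarrow> 0 < c p j" using that by (auto simp: F_def)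
    have "(\<Prod>k = 1..n. mu (gramian e S p) k) = (\<Prod>j\<in>J. c p j)"
      using diagonal_op.prod_mu[OF diag[OF p(1)], of "\<lambda>u. u"] J by simp
    moreover have "ln (\<Prod>j\<in>J. c p j) = (\<Sum>j\<in>J. ln (c p j))"
      using p(2) J by (intro ln_prod) fastforce+
    ultimately show ?thesis by (simp add: log_volume_cost_def sum_negf)
  qed
  have trace_cost: "inverse_trace_cost e S n p = (\<Sum>j\<in>J. 1 / c p j)" if "p \<in> F" for p
    using diagonal_op.sum_mu[OF diag, of p "\<lambda>u. 1 / u"] that J
    by (simp add: inverse_trace_cost_def F_def)
  \<comment> \<open>Equal coefficients give equal Gramians, and linear independence of the
    \<open>W\<^sub>i\<close> with \<open>i\<close> in \<open>I\<close> then gives equal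
    weights.\<close>
  have inj: "p = q" if "p \<in> F" "q \<in> F" and eq: "\<And>j. j \<in> J \<Longrightarrow> c p j = c q j" for p q
  proof
    fix k
    have simp: "p \<in> simplex_on I" "q \<in> simplex_on I" using that by (auto simp: F_def)
    have "(\<Sum>i\<in>I. (p i - q i) *\<^sub>R gramian_single e S i x) = 0" for x
    proof -
      have "gramian e S p x = gramian e S q x" using gram simp eq by simp
      then show ?thesis
        using gramian_eq_sum[OF assms(6), of p x] gramian_eq_sum[OF assms(6), of q x] simp
        by (simp add: simplex_on_def scaleR_diff_left sum_subtractf)
    qed
    then have "p k - q k = 0" if "k \<in> I"
      using gramian_single_independent[OF assms(6), of "\<lambda>i. p i - q i"] that by blast
    then show "p k = q k" using simp by (cases "k \<in> I") (auto simp: simplex_on_def)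
  qed
  have "F \<noteq> {}" using assms(7) feasible by simp
  \<comment> \<open>Everything independent of the cost is discharged once; what remains concerns
    only the profile \<phi>, which is \<open>- ln u\<close> for one problem and \<open>1 / u\<close>
    for the other.\<close>
  note minimizer = ex1_arg_min_separable[where a = lam and I = I and J = J, folded c_def,
      folded F_def, OF assms(6) J(1) this assms(10) inj]
  have "\<exists>!p. is_arg_min (log_volume_cost e S n) (\<lambda>p. p \<in> F) p"
  proof (rule minimizer[where \<phi> = "\<lambda>u. - ln u"])
    show "continuous_on {0<..} (\<lambda>u::real. - ln u)" by (intro continuous_intros) auto
    show "filterlim (\<lambda>u::real. - ln u) at_top (at_right 0)"
      using ln_at_0 by (simp add: filterlim_uminus_at_top)
  qed (use minus_ln_midpoint_less log_cost in auto)
  moreover have "\<exists>!p. is_arg_min (inverse_trace_cost e S n) (\<lambda>p. p \<in> F) p"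
  proof (rule minimizer[where \<phi> = "\<lambda>u. 1 / u"])
    show "continuous_on {0<..} (\<lambda>u::real. 1 / u)" by (intro continuous_intros) auto
    show "filterlim (\<lambda>u::real. 1 / u) at_top (at_right 0)"
      using filterlim_inverse_at_top_right by (simp add: inverse_eq_divide)
  qed (use inverse_midpoint_less trace_cost in \<open>auto intro: divide_left_mono\<close>)
  ultimately show ?thesis by (simp add: feasible)
qed

end
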